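(* Assume there exists a barrier digit $b$. Then $$(\underline{\alpha},\alpha^* )\cup\{\delta\log p_m\}\cup\{\overline{\alpha}\}\subset\Delta\mu.$$
   Context: Fix integers $d\ge 3$ and $m\ge d$ and a probability vector $\mathbf p=(p_0,\dots,p_m)$ with all $p_i>0$ which is regular, normalized so that $p_0\le p_m\le p_i$ for all $1\le i\le m-1$. Let $\mathcal A=\{0,\dots,m\}$; $\mathcal A^k$ is the set of words of length $k$, $\mathcal A^*=\bigcup_{k\ge0}\mathcal A^k$, $\mathcal A^{\mathbb N}$ the set of infinite sequences; $|\sigma|$ is the length of $\sigma$, $\sigma_j$ its $j$-th letter. Put $\delta=-1/\log d$ and $\xi=m/(d-1)$. Define $\pi(\sigma)=\sum_{i}\sigma_i d^{-i}$ for finite or infinite words. Let $\mu$ be the unique compactly supported Borel probability measure with $\mu(A)=\sum_{i=0}^m p_i\,\mu(dA-i)$ for all Borel $A$; its support is $[0,\xi]$. Let $a=1+\lfloor (m-d)/(d-1)\rfloor$, set $p_j=0$ for $j\notin\mathcal A$, and for $i\in\mathcal A$ let $M_i$ be the $(2a+1)\times(2a+1)$ matrix indexed by $\{-a,\dots,a\}^2$ with $M_i(k,l)=p_{k+i-ld}$; for $\sigma\in\mathcal A^k$ let $M(\sigma)=M_{\sigma_k}\cdots M_{\sigma_1}$. $\rho$ denotes spectral radius and $\tilde\rho(\mathcal M)=\limsup_{k}\left(\sup\{\rho(A_1\cdots A_k):A_i\in\mathcal M\}\right)^{1/k}$ the generalized spectral radius. Set $\underline{\alpha}=\delta\log\tilde\rho(M_0,\dots,M_m)$,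 $\alpha^*=\delta\log\inf\{\rho(M(\sigma))^{1/|\sigma|}:\sigma\in\mathcal A^*,\ \sigma_1\notin\{0,m\}\}$, $\overline{\alpha}=\delta\log p_0$. Local dimension: $\dim\mu(x)=\lim_{r\to0^+}\frac{\log\mu(B(x,r))}{\log r}$ when the limit exists, and $\Delta\mu=\{\dim\mu(x):x\in\operatorname{supp}\mu,\ \dim\mu(x)\text{ exists}\}$. A digit $b\in\mathcal A$ is a barrier digit if for every $\omega\in\mathcal A^{\mathbb N}$ with $\omega_1=b$ one has $\pi(\omega)-1<0<\xi<\pi(\omega)+1$. *)

theory Defs
  imports "HOL-Probability.Probability" "Jordan_Normal_Form.Spectral_Radius"
begin

text \<open>Digits are natural numbers 0..m; finite words are lists (letter sigma_1 is the head);
infinite words are functions nat => nat, letter omega_j being omega (j-1).\<close>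

definition pext :: "nat \<Rightarrow> (nat \<Rightarrow> real) \<Rightarrow> int \<Rightarrow> real" where
  "pext m p j = (if 0 \<le> j \<and> j \<le> int m then p (nat j) else 0)"

definition a_par :: "nat \<Rightarrow> nat \<Rightarrow> nat" where
  "a_par d m = 1 + (m - d) div (d - 1)"

text \<open>Matrix M_i, rows/columns indexed by -a..a, stored at positions 0..2a.\<close>
definition Mi :: "nat \<Rightarrow> nat \<Rightarrow> (nat \<Rightarrow> real) \<Rightarrow> nat \<Rightarrow> real mat" where
  "Mi d m p i = (let a = a_par d m in
     mat (2*a+1) (2*a+1) (\<lambda>(r,c). pext m p ((int r - int a) + int i - (int c - int a) * int d)))"

definition Mword :: "nat \<Rightarrow> nat \<Rightarrow> (nat \<Rightarrow> real) \<Rightarrow> nat list \<Rightarrow> real mat" where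
  "Mword d m p \<sigma> = foldl (\<lambda>A s. Mi d m p s * A) (1\<^sub>m (2 * a_par d m + 1)) \<sigma>"

definition rho :: "real mat \<Rightarrow> real" where
  "rho A = spectral_radius (map_mat complex_of_real A)"

definition words :: "nat \<Rightarrow> nat \<Rightarrow> nat list set" where
  "words m k = {\<sigma>. length \<sigma> = k \<and> set \<sigma> \<subseteq> {0..m}}"

definition gen_spec_rad :: "nat \<Rightarrow> nat \<Rightarrow> (nat \<Rightarrow> real) \<Rightarrow> real" where
  "gen_spec_rad d m p = real_of_ereal (limsup (\<lambda>k.
      ereal ((Sup (rho ` Mword d m p ` words m k)) powr (1 / real k))))"

definition delta_log :: "nat \<Rightarrow> real \<Rightarrow> real" where
  "delta_log d x = (- 1 / ln (real d)) * ln x"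

definition alpha_lower :: "nat \<Rightarrow> nat \<Rightarrow> (nat \<Rightarrow> real) \<Rightarrow> real" where
  "alpha_lower d m p = delta_log d (gen_spec_rad d m p)"

definition alpha_star :: "nat \<Rightarrow> nat \<Rightarrow> (nat \<Rightarrow> real) \<Rightarrow> real" where
  "alpha_star d m p = delta_log d (Inf {rho (Mword d m p \<sigma>) powr (1 / real (length \<sigma>)) | \<sigma>.
      \<sigma> \<noteq> [] \<and> set \<sigma> \<subseteq> {0..m} \<and> hd \<sigma> \<notin> {0, m}})"

definition alpha_upper :: "nat \<Rightarrow> nat \<Rightarrow> (nat \<Rightarrow> real) \<Rightarrow> real" where
  "alpha_upper d m p = delta_log d (p 0)"

definition proj :: "nat \<Rightarrow> (nat \<Rightarrow> nat) \<Rightarrow> real" where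
  "proj d \<omega> = (\<Sum>i. real (\<omega> i) / real d ^ (Suc i))"

definition barrier_digit :: "nat \<Rightarrow> nat \<Rightarrow> nat \<Rightarrow> bool" where
  "barrier_digit d m b \<longleftrightarrow> b \<le> m \<and>
     (\<forall>\<omega>. (\<forall>i. \<omega> i \<le> m) \<and> \<omega> 0 = b \<longrightarrow>
        proj d \<omega> - 1 < 0 \<and> 0 < real m / (real d - 1) \<and> real m / (real d - 1) < proj d \<omega> + 1)"

text \<open>mu is a compactly supported Borel probability measure with
  mu(A) = sum_i p_i mu(dA - i) (this determines mu uniquely).\<close>
definition self_similar :: "nat \<Rightarrow> nat \<Rightarrow> (nat \<Rightarrow> real) \<Rightarrow> real measure \<Rightarrow> bool" where
  "self_similar d m p \<mu> \<longleftrightarrow> prob_space \<mu> \<and> sets \<mu> = sets borel \<and>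
     (\<exists>K. compact K \<and> emeasure \<mu> K = 1) \<and>
     (\<forall>A \<in> sets borel. measure \<mu> A =
        (\<Sum>i\<le>m. p i * measure \<mu> ((\<lambda>x. real d * x - real i) ` A)))"

definition support :: "real measure \<Rightarrow> real set" where
  "support \<mu> = {x. \<forall>r>0. measure \<mu> (ball x r) > 0}"

definition has_local_dim :: "real measure \<Rightarrow> real \<Rightarrow> real \<Rightarrow> bool" where
  "has_local_dim \<mu> x L \<longleftrightarrow>
     ((\<lambda>r. ln (measure \<mu> (ball x r)) / ln r) \<longlongrightarrow> L) (at_right 0)"

definition local_dims :: "real measure \<Rightarrow> real set" where
  "local_dims \<mu> = {L. \<exists>x \<in> support \<mu>. has_local_dim \<mu> x L}"

end

theory Submission
  imports Defs
begin

text \<open>A barrier digit forces \<open>a = 1\<close> and makes \<open>M_b\<close> vanish outside its central column. Hence the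
  central entry of \<open>M(\<sigma>)\<close>, called the weight of \<open>\<sigma>\<close>, is multiplicative when words starting with
  \<open>b\<close> are appended, and just before an occurrence of \<open>b\<close> it determines the measure of a small ball
  up to a bounded factor. For \<open>\<alpha>\<close> in the open interval put \<open>t = d powr (- \<alpha>)\<close>. The generalized
  spectral radius provides a word \<open>b u\<close> of length \<open>n\<close> and weight at least \<open>t ^ n\<close>; high powers of a
  word with small spectral radius provide a word \<open>b v\<close> of length \<open>n\<close> and weight at most \<open>t ^ n\<close>.
  Concatenating these two blocks greedily gives a point of local dimension \<open>\<alpha>\<close>. The two isolated
  values are attained at the endpoints of the support, where only one term of the self-similarity
  relation survives.\<close>

section \<open>Spectral radius and matrix powers\<close>

text \<open>An eigenvector is compared with its image in the l1 norm: every component of the image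
  is at most the absolute row sum times the norm \<open>s\<close> of the vector. Adding up the rows
  and cancelling \<open>s\<close> gives the bound.\<close>

lemma spectral_radius_le_sum_norm:
  fixes A :: "complex mat"
  assumes A: "A \<in> carrier_mat n n" and n: "n > 0"
  shows "spectral_radius A \<le> (\<Sum>i<n. \<Sum>j<n. norm (A $$ (i,j)))"
proof -
  obtain ev where ev: "ev \<in> spectrum A" "spectral_radius A = norm ev"
    using spectral_radius_mem_max(1)[OF A n] by auto
  then obtain v where v: "v \<in> carrier_vec n" "v \<noteq> 0\<^sub>v n" "A *\<^sub>v v = ev \<cdot>\<^sub>v v"
    using A by (auto simp: spectrum_def eigenvalue_def eigenvector_def)
  define s where "s = (\<Sum>i<n. norm (vec_index v i))"
  have "s \<noteq> 0"
  proof
    assume "s = 0"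
    then have "\<forall>i<n. vec_index v i = 0"
      unfolding s_def by (subst (asm) sum_nonneg_eq_0_iff) auto
    then have "v = 0\<^sub>v n" using v(1) by (intro eq_vecI) auto
    with v(2) show False by simp
  qed
  moreover have "s \<ge> 0" unfolding s_def by (intro sum_nonneg) auto
  ultimately have s: "s > 0" by simp
  have comp: "norm ev * norm (vec_index v i) \<le> (\<Sum>j<n. norm (A $$ (i,j))) * s" if i: "i < n" for i
  proof -
    have "ev * vec_index v i = vec_index (A *\<^sub>v v) i" using i v by simp
    also have "\<dots> = (\<Sum>j<n. A $$ (i,j) * vec_index v j)"
      using i v(1) A by (auto simp: scalar_prod_def lessThan_atLeast0 intro!: sum.cong)
    finally have "norm ev * norm (vec_index v i) = norm (\<Sum>j<n. A $$ (i,j) * vec_index v j)"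
      by (metis norm_mult)
    also have "\<dots> \<le> (\<Sum>j<n. norm (A $$ (i,j)) * norm (vec_index v j))"
      by (rule order_trans[OF norm_sum]) (simp add: norm_mult)
    also have "\<dots> \<le> (\<Sum>j<n. norm (A $$ (i,j)) * s)"
      unfolding s_def by (intro sum_mono mult_left_mono member_le_sum) auto
    finally show ?thesis by (simp add: sum_distrib_right)
  qed
  have "norm ev * s \<le> (\<Sum>i<n. (\<Sum>j<n. norm (A $$ (i,j))) * s)"
    by (subst (1) s_def, subst sum_distrib_left) (intro sum_mono comp, simp)
  also have "\<dots> = (\<Sum>i<n. \<Sum>j<n. norm (A $$ (i,j))) * s" by (simp add: sum_distrib_right)
  finally show ?thesis using s ev(2) by simp
qed

lemma pow_mat_smult:
  fixes A :: "'a :: comm_semiring_1 mat"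
  assumes A: "A \<in> carrier_mat n n"
  shows "(c \<cdot>\<^sub>m A) ^\<^sub>m k = (c ^ k) \<cdot>\<^sub>m (A ^\<^sub>m k)"
proof (induction k)
  case (Suc k)
  have "A ^\<^sub>m k \<in> carrier_mat n n" using A by simp
  then show ?case using A Suc
    by (auto simp: mult_smult_assoc_mat[of _ n n _ n] mult_smult_distrib[of _ n n _ n]
        mult.assoc intro!: eq_matI)
qed (use A in \<open>auto intro!: eq_matI\<close>)

text \<open>An eigenvalue \<open>ev\<close> of the scaled matrix belongs to the eigenvalue
  \<open>t * ev\<close> of \<open>A\<close>. The scaling reduces growth rates to the case of radius
  below one.\<close>

lemma spectral_radius_smult_less_1:
  fixes A :: "complex mat"
  assumes A: "A \<in> carrier_mat n n" and n: "n > 0" and t: "spectral_radius A < t" "t > 0"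
  shows "spectral_radius (complex_of_real (1 / t) \<cdot>\<^sub>m A) < 1"
proof -
  let ?B = "complex_of_real (1 / t) \<cdot>\<^sub>m A"
  have B: "?B \<in> carrier_mat n n" using A by simp
  obtain ev where ev: "ev \<in> spectrum ?B" "spectral_radius ?B = norm ev"
    using spectral_radius_mem_max(1)[OF B n] by auto
  then obtain v where v: "v \<in> carrier_vec n" "v \<noteq> 0\<^sub>v n" "?B *\<^sub>v v = ev \<cdot>\<^sub>v v"
    using A by (auto simp: spectrum_def eigenvalue_def eigenvector_def)
  have "A *\<^sub>v v = (of_real t * ev) \<cdot>\<^sub>v v"
  proof (rule eq_vecI)
    fix i assume "i < dim_vec ((of_real t * ev) \<cdot>\<^sub>v v)"
    then have i: "i < n" using v by simp
    have "of_real (1 / t) * vec_index (A *\<^sub>v v) i = ev * vec_index v i"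
      using arg_cong[OF v(3), of "\<lambda>x. vec_index x i"] i A v(1)
      by (simp add: scalar_prod_def sum_distrib_left mult.assoc)
    then show "vec_index (A *\<^sub>v v) i = vec_index ((of_real t * ev) \<cdot>\<^sub>v v) i"
      using i v(1) t(2) by (simp add: field_simps)
  qed (use A v in auto)
  then have "of_real t * ev \<in> spectrum A"
    using v A by (auto simp: spectrum_def eigenvalue_def eigenvector_def)
  then have "norm (of_real t * ev) \<le> spectral_radius A"
    by (intro spectral_radius_mem_max(2)[OF A n]) auto
  then have "t * norm ev \<le> spectral_radius A" using t(2) by (simp add: norm_mult)
  also have "\<dots> < t * 1" using t(1) by simp
  finally have "t * norm ev < t * 1" .
  then have "norm ev < 1" using t(2) by (simp only: mult_less_cancel_left_pos)
  then show ?thesis by (simp only: ev(2))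
qed

text \<open>The powers of \<open>A / t\<close> stay bounded because the spectral radius is below
  one; undoing the scaling produces the factor \<open>t ^ k\<close>.\<close>

lemma pow_mat_bound_of_spectral_radius_less:
  fixes A :: "complex mat"
  assumes A: "A \<in> carrier_mat n n" and n: "n > 0" and t: "spectral_radius A < t" "t > 0"
  obtains C where "\<And>k i j. i < n \<Longrightarrow> j < n \<Longrightarrow> norm ((A ^\<^sub>m k) $$ (i,j)) \<le> C * t ^ k"
proof -
  let ?B = "complex_of_real (1 / t) \<cdot>\<^sub>m A"
  have B: "?B \<in> carrier_mat n n" using A by simp
  obtain C where C: "\<And>k. norm_bound (?B ^\<^sub>m k) C"
    using spectral_radius_jnf_norm_bound_less_1_upper_triangular[OF B
        spectral_radius_smult_less_1[OF A n t]] by blast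
  have "norm ((A ^\<^sub>m k) $$ (i,j)) \<le> C * t ^ k" if ij: "i < n" "j < n" for k i j
  proof -
    have Ak: "A ^\<^sub>m k \<in> carrier_mat n n" using A by simp
    have "norm ((?B ^\<^sub>m k) $$ (i,j)) \<le> C"
      using C[of k] ij A unfolding norm_bound_def by (simp add: pow_mat_smult[OF A])
    then have "norm ((A ^\<^sub>m k) $$ (i,j)) / t ^ k \<le> C"
      using ij A Ak t(2)
      by (simp add: pow_mat_smult[OF A] norm_mult norm_power norm_divide power_one_over divide_simps)
    then show ?thesis using t(2) by (simp add: field_simps)
  qed
  then show ?thesis by (rule that)
qed

lemma mult_entry_3:
  fixes A B :: "'a :: semiring_0 mat"
  assumes "A \<in> carrier_mat 3 3" "B \<in> carrier_mat 3 3" "r < 3" "c < 3"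
  shows "(A * B) $$ (r,c) = (\<Sum>k<3. A $$ (r,k) * B $$ (k,c))"
  using assms by (auto simp: scalar_prod_def lessThan_atLeast0 intro!: sum.cong)

lemma less_power_of_less_root:
  fixes T X :: real
  assumes "T < X powr (1 / real k)" "k > 0" "T > 0" "X \<ge> 0"
  shows "T ^ k < X"
proof (rule ccontr)
  assume "\<not> T ^ k < X"
  then have "X powr (1 / real k) \<le> (T ^ k) powr (1 / real k)"
    using assms by (intro powr_mono2) auto
  also have "\<dots> = T" using assms by (simp add: powr_realpow[symmetric] powr_powr)
  finally show False using assms by simp
qed

lemma power_less_of_root_less:
  fixes T X :: real
  assumes "X powr (1 / real k) < T" "k > 0" "X \<ge> 0"
  shows "X < T ^ k"
proof (rule ccontr)
  have T: "T > 0" using assms(1) powr_ge_zero[of X "1 / real k"] by linarith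
  assume "\<not> X < T ^ k"
  then have "(T ^ k) powr (1 / real k) \<le> X powr (1 / real k)"
    using assms T by (intro powr_mono2) auto
  moreover have "(T ^ k) powr (1 / real k) = T"
    using assms T by (simp add: powr_realpow[symmetric] powr_powr)
  ultimately show False using assms by simp
qed

section \<open>Local dimensions from sparse scales\<close>

text \<open>Division by \<open>ln r\<close>, which tends to minus infinity, makes any bounded error
  disappear in the limit.\<close>

lemma has_local_dim_of_log_bound:
  assumes r0: "r0 > 0"
    and bound: "\<And>r. 0 < r \<Longrightarrow> r < r0 \<Longrightarrow> \<bar>ln (measure \<mu> (ball x r)) - \<alpha> * ln r\<bar> \<le> C"
  shows "has_local_dim \<mu> x \<alpha>"
proof -
  let ?f = "\<lambda>r. ln (measure \<mu> (ball x r)) / ln r"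
  have ev: "\<forall>\<^sub>F r in at_right 0. 0 < r \<and> r < min r0 1"
    using eventually_at_right_real[of 0 "min r0 1"] r0 by simp
  have "((\<lambda>r. C / ln r) \<longlongrightarrow> 0) (at_right 0)"
    by (intro tendsto_divide_0[OF tendsto_const] filterlim_at_bot_imp_at_infinity ln_at_0)
  then have "((\<lambda>r. \<bar>C / ln r\<bar>) \<longlongrightarrow> 0) (at_right 0)"
    by (rule tendsto_rabs_zero)
  moreover have "\<forall>\<^sub>F r in at_right 0. norm (?f r - \<alpha>) \<le> \<bar>C / ln r\<bar>"
    using ev
  proof eventually_elim
    case (elim r)
    then have ln: "ln r < 0" by simp
    then have "?f r - \<alpha> = (ln (measure \<mu> (ball x r)) - \<alpha> * ln r) / ln r"
      by (simp add: diff_divide_distrib)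
    then have "\<bar>?f r - \<alpha>\<bar> = \<bar>ln (measure \<mu> (ball x r)) - \<alpha> * ln r\<bar> / \<bar>ln r\<bar>"
      by (simp only: abs_divide)
    also have "\<dots> \<le> \<bar>C\<bar> / \<bar>ln r\<bar>"
      using bound[of r] elim by (intro divide_right_mono) auto
    finally show ?case by simp
  qed
  ultimately have "((\<lambda>r. ?f r - \<alpha>) \<longlongrightarrow> 0) (at_right 0)"
    by (rule Lim_null_comparison[rotated])
  then show ?thesis unfolding has_local_dim_def by (simp add: LIM_zero_iff)
qed

text \<open>Every small radius lies between two consecutive scales. Since the exponents jump by at
  most \<open>L\<close>, both \<open>ln r\<close> and the logarithm of the measure differ from their
  values at the scale by a bounded amount.\<close>

lemma has_local_dim_along_scales:
  fixes M :: "real measure" and N :: "nat \<Rightarrow> nat" and x g t :: real and d L :: nat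
  assumes "finite_measure M" and M: "sets M = sets borel" and d: "d > 1" and g: "g > 0" and t: "t > 0"
    and N: "N 0 = 0" "\<And>i. i \<le> N i" "\<And>i. N i \<le> N (Suc i)" "\<And>i. N (Suc i) \<le> N i + L"
    and pos: "\<And>i. measure M (ball x (g / real d ^ N i)) > 0"
    and bound: "\<And>i. \<bar>ln (measure M (ball x (g / real d ^ N i))) - real (N i) * ln t\<bar> \<le> C"
  shows "has_local_dim M x (delta_log d t)"
proof (rule has_local_dim_of_log_bound[OF g])
  interpret finite_measure M by fact
  fix r :: real assume r: "0 < r" "r < g"
  let ?D = "real d"
  have D: "?D > 1" using d by simp
  have lnD: "ln ?D > 0" using D by simp
  obtain n where n: "g / r < ?D ^ n" using real_arch_pow[OF D] by blast
  have "?D ^ n \<le> ?D ^ N n" using D N(2) by (intro power_increasing) auto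
  then have "g / r < ?D ^ N n" using n by linarith
  then have "g / ?D ^ N n < r" using r D by (simp add: divide_simps mult.commute)
  \<comment> \<open>As \<open>N 0 = 0\<close>, the initial scale is \<open>g\<close> itself, so the
    least index whose scale falls below \<open>r\<close> is a successor.\<close>
  moreover have "\<not> g / ?D ^ N 0 < r" using r N(1) by simp
  ultimately obtain i where i: "\<not> g / ?D ^ N i < r" "g / ?D ^ N (Suc i) < r"
    using ex_least_nat_less[of "\<lambda>j. g / ?D ^ N j < r" n] by auto
  define m0 where "m0 = measure M (ball x r)"
  have "measure M (ball x (g / ?D ^ N (Suc i))) \<le> m0"
    unfolding m0_def using i by (intro finite_measure_mono) (auto simp: M)
  moreover have "m0 \<le> measure M (ball x (g / ?D ^ N i))"
    unfolding m0_def using i by (intro finite_measure_mono) (auto simp: M)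
  ultimately have "ln (measure M (ball x (g / ?D ^ N (Suc i)))) \<le> ln m0"
      "ln m0 \<le> ln (measure M (ball x (g / ?D ^ N i)))"
    using pos[of i] pos[of "Suc i"] by auto
  moreover have jump: "\<bar>real (N (Suc i)) * a - real (N i) * a\<bar> \<le> real L * \<bar>a\<bar>" for a
  proof -
    have "\<bar>real (N (Suc i)) * a - real (N i) * a\<bar> = (real (N (Suc i)) - real (N i)) * \<bar>a\<bar>"
      using N(3)[of i] by (simp add: abs_mult flip: left_diff_distrib)
    also have "\<dots> \<le> real L * \<bar>a\<bar>" using N(4)[of i] by (intro mult_right_mono) auto
    finally show ?thesis .
  qed
  ultimately have 1: "\<bar>ln m0 - real (N i) * ln t\<bar> \<le> C + real L * \<bar>ln t\<bar>"
    using bound[of i] bound[of "Suc i"] jump[of "ln t"] by linarith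
  have "ln (g / ?D ^ N (Suc i)) < ln r" "ln r \<le> ln (g / ?D ^ N i)"
    using i r g D by auto
  then have 2: "\<bar>ln r + real (N i) * ln ?D\<bar> \<le> \<bar>ln g\<bar> + real L * \<bar>ln ?D\<bar>"
    using jump[of "ln ?D"] g D by (simp add: ln_div ln_realpow)
  \<comment> \<open>\<open>Z\<close> is the error made when \<open>ln r\<close> is replaced by
    \<open>- N i * ln d\<close> in \<open>delta_log d t * ln r\<close>; by 2 it is bounded.\<close>
  define Z where "Z = (ln t / ln ?D) * (ln r + real (N i) * ln ?D)"
  have "delta_log d t * ln r = real (N i) * ln t - Z"
    using lnD by (simp add: delta_log_def Z_def field_simps)
  then have "\<bar>ln m0 - delta_log d t * ln r\<bar> \<le> \<bar>ln m0 - real (N i) * ln t\<bar> + \<bar>Z\<bar>"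
    by linarith
  also have "\<dots> \<le> (C + real L * \<bar>ln t\<bar>) + \<bar>ln t / ln ?D\<bar> * (\<bar>ln g\<bar> + real L * \<bar>ln ?D\<bar>)"
    unfolding Z_def abs_mult using 1 2 by (intro add_mono mult_left_mono) auto
  finally show "\<bar>ln (measure M (ball x r)) - delta_log d t * ln r\<bar>
      \<le> (C + real L * \<bar>ln t\<bar>) + \<bar>ln t / ln ?D\<bar> * (\<bar>ln g\<bar> + real L * \<bar>ln ?D\<bar>)"
    by (simp add: m0_def)
qed

section \<open>The self-similar measure\<close>

locale barrier_system =
  fixes d m :: nat and p :: "nat \<Rightarrow> real" and \<mu> :: "real measure" and b :: nat
  assumes d3: "d \<ge> 3" and md: "m \<ge> d"
    and ppos: "\<And>i. i \<le> m \<Longrightarrow> p i > 0" and psum: "(\<Sum>i\<le>m. p i) = 1"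
    and ssim: "self_similar d m p \<mu>"
    and barrier: "barrier_digit d m b"
begin

section \<open>Expansions in base \<open>d\<close> and the inequalities forced by a barrier
  digit\<close>

abbreviation digits :: "(nat \<Rightarrow> nat) \<Rightarrow> bool" where
  "digits \<omega> \<equiv> (\<forall>i. \<omega> i \<le> m)"

text \<open>The value of the expansion with all digits \<open>m\<close>, which is the right end
  point of the support.\<close>

definition xi :: real where
  "xi = real m / (real d - 1)"

lemma d_gt_1: "real d > 1"
  using d3 by linarith

lemma xi_fixed: "real d * xi = xi + real m"
  unfolding xi_def using d_gt_1 by (simp add: field_simps)

lemma xi_gt_1: "xi > 1"
  unfolding xi_def using d_gt_1 md by (simp add: field_simps)

lemma summable_digits:
  assumes "digits \<omega>"
  shows "summable (\<lambda>i. real (\<omega> i) / real d ^ Suc i)"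
proof (rule summable_comparison_test')
  show "summable (\<lambda>i. real m / real d * (1 / real d) ^ i)"
    using d_gt_1 by (intro summable_mult summable_geometric) auto
  show "norm (real (\<omega> i) / real d ^ Suc i) \<le> real m / real d * (1 / real d) ^ i" for i
    using assms d_gt_1 by (simp add: field_simps power_one_over)
qed

lemma proj_const: "proj d (\<lambda>_. c) = real c / (real d - 1)"
proof -
  have "(\<lambda>i. real c / real d * (1 / real d) ^ i) sums (real c / real d * (1 / (1 - 1 / real d)))"
    using d_gt_1 by (intro sums_mult geometric_sums) auto
  moreover have "(\<lambda>i. real c / real d * (1 / real d) ^ i) = (\<lambda>i. real c / real d ^ Suc i)"
    by (auto simp: power_one_over)
  moreover have "real c / real d * (1 / (1 - 1 / real d)) = real c / (real d - 1)"
    using d_gt_1 by (simp add: field_simps)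
  ultimately show ?thesis unfolding proj_def by (simp add: sums_iff)
qed

lemma proj_bounds:
  assumes "digits \<omega>"
  shows "0 \<le> proj d \<omega>" "proj d \<omega> \<le> xi"
proof -
  show "0 \<le> proj d \<omega>"
    unfolding proj_def by (intro suminf_nonneg summable_digits assms) auto
  have "proj d \<omega> \<le> proj d (\<lambda>_. m)"
    unfolding proj_def using assms d_gt_1
    by (intro suminf_le summable_digits) (auto intro!: divide_right_mono)
  then show "proj d \<omega> \<le> xi" by (simp add: proj_const xi_def)
qed

lemma proj_shift:
  assumes "digits \<omega>"
  shows "proj d (\<lambda>i. \<omega> (Suc i)) = real d * proj d \<omega> - real (\<omega> 0)"
proof -
  have "(\<Sum>i. real (\<omega> (Suc i)) / real d ^ Suc (Suc i)) = proj d \<omega> - real (\<omega> 0) / real d"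
    unfolding proj_def using suminf_split_head[OF summable_digits[OF assms]] by simp
  moreover have "summable (\<lambda>i. real (\<omega> (Suc i)) / real d ^ Suc i)"
    using summable_digits[of "\<lambda>i. \<omega> (Suc i)"] assms by simp
  then have "(\<Sum>i. real (\<omega> (Suc i)) / real d ^ Suc i / real d) = proj d (\<lambda>i. \<omega> (Suc i)) / real d"
    unfolding proj_def by (intro suminf_divide)
  ultimately have "proj d (\<lambda>i. \<omega> (Suc i)) / real d = proj d \<omega> - real (\<omega> 0) / real d"
    by (simp add: field_simps)
  then show ?thesis using d_gt_1 by (simp add: field_simps)
qed

lemma proj_Cons_const:
  assumes "c \<le> m" "e \<le> m"
  shows "proj d (case_nat c (\<lambda>_. e)) = (real c + real e / (real d - 1)) / real d"
  using proj_shift[of "case_nat c (\<lambda>_. e)"] assms d_gt_1 proj_const[of e]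
  by (simp add: field_simps split: nat.splits)

lemma b_le: "b \<le> m"
  using barrier by (simp add: barrier_digit_def)

text \<open>The sharpest instance of the left barrier inequality: after \<open>b\<close>, all digits
  are \<open>m\<close>.\<close>

lemma barrier_upper: "real b + xi < real d"
proof -
  have "proj d (case_nat b (\<lambda>_. m)) < 1"
    using barrier b_le unfolding barrier_digit_def by (force split: nat.splits)
  then show ?thesis
    using proj_Cons_const[OF b_le, of m] d_gt_1 by (simp add: xi_def)
qed

text \<open>The sharpest instance of the right barrier inequality: after \<open>b\<close>, all
  digits are \<open>0\<close>.\<close>

lemma barrier_lower: "xi < real b / real d + 1"
proof -
  have "real m / (real d - 1) < proj d (case_nat b (\<lambda>_. 0)) + 1"
    using barrier b_le unfolding barrier_digit_def by (force split: nat.splits)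
  then show ?thesis using proj_Cons_const[OF b_le, of 0] by (simp add: xi_def)
qed

lemma b_plus_1_less: "b + 1 < d"
  using barrier_upper xi_gt_1 by linarith

lemma b_ge_1: "b \<ge> 1"
  using barrier_lower xi_gt_1 by (cases b) auto

lemma m_less: "m + 1 < b + d"
proof -
  have "real m < (real b / real d + 1) * (real d - 1)"
    using barrier_lower d_gt_1 unfolding xi_def by (simp add: divide_simps)
  also have "\<dots> = real b - real b / real d + real d - 1" using d_gt_1 by (simp add: field_simps)
  also have "\<dots> < real b + real d - 1" using b_ge_1 d_gt_1 by simp
  finally show ?thesis by linarith
qed

text \<open>The integer inequalities give \<open>m - d < b - 1 < d - 1\<close>, so the quotient
  vanishes and all matrices are 3 by 3.\<close>

lemma a_par_1: "a_par d m = 1"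
  using m_less b_plus_1_less d3 by (simp add: a_par_def)

section \<open>The scaling relation for rays and balls\<close>

lemma prob_mu: "prob_space \<mu>" and sets_mu: "sets \<mu> = sets borel"
  using ssim by (auto simp: self_similar_def)

lemma space_mu: "space \<mu> = UNIV"
  using sets_eq_imp_space_eq[OF sets_mu] by simp

lemma measure_self_similar:
  "A \<in> sets borel \<Longrightarrow>
     measure \<mu> A = (\<Sum>i\<le>m. p i * measure \<mu> ((\<lambda>x. real d * x - real i) ` A))"
  using ssim by (auto simp: self_similar_def)

sublocale prob_space \<mu> by (rule prob_mu)

lemma measure_mu_mono: "A \<subseteq> B \<Longrightarrow> B \<in> sets borel \<Longrightarrow> measure \<mu> A \<le> measure \<mu> B"
  by (intro finite_measure_mono) (auto simp: sets_mu)

lemma affine_image_lessThan: "(\<lambda>x. real d * x - c) ` {..<t} = {..<real d * t - c}"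
proof -
  have "x \<in> (\<lambda>x. real d * x - c) ` {..<t}" if "x < real d * t - c" for x
    using that d_gt_1 by (intro image_eqI[of _ _ "(x + c) / real d"]) (auto simp: field_simps)
  then show ?thesis using d_gt_1 by auto
qed

lemma affine_image_greaterThan: "(\<lambda>x. real d * x - c) ` {t<..} = {real d * t - c<..}"
proof -
  have "x \<in> (\<lambda>x. real d * x - c) ` {t<..}" if "x > real d * t - c" for x
    using that d_gt_1 by (intro image_eqI[of _ _ "(x + c) / real d"]) (auto simp: field_simps)
  then show ?thesis using d_gt_1 by auto
qed

lemma affine_image_ball: "(\<lambda>x. real d * x - c) ` ball y r = ball (real d * y - c) (real d * r)"
proof -
  have "x \<in> (\<lambda>x. real d * x - c) ` ball y r" if "x \<in> ball (real d * y - c) (real d * r)" for x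
  proof (rule image_eqI[of _ _ "(x + c) / real d"])
    have "real d * \<bar>y - (x + c) / real d\<bar> = \<bar>real d * (y - (x + c) / real d)\<bar>"
      using d_gt_1 by (simp add: abs_mult)
    also have "real d * (y - (x + c) / real d) = real d * y - c - x"
      using d_gt_1 by (simp add: right_diff_distrib)
    also have "\<bar>real d * y - c - x\<bar> < real d * r" using that by (simp add: dist_real_def)
    finally have "\<bar>y - (x + c) / real d\<bar> < r" using d_gt_1 mult_less_cancel_left_pos by force
    then show "(x + c) / real d \<in> ball y r" by (simp add: dist_real_def)
  qed (use d_gt_1 in simp)
  moreover have "real d * x - c \<in> ball (real d * y - c) (real d * r)" if "x \<in> ball y r" for x
  proof -
    have "\<bar>real d * y - c - (real d * x - c)\<bar> = real d * \<bar>y - x\<bar>"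
      using d_gt_1 by (simp add: abs_mult flip: right_diff_distrib)
    then show ?thesis using that d_gt_1 by (simp add: dist_real_def)
  qed
  ultimately show ?thesis by auto
qed

lemma measure_ball_self_similar:
  "measure \<mu> (ball y r) = (\<Sum>i\<le>m. p i * measure \<mu> (ball (real d * y - real i) (real d * r)))"
  by (subst measure_self_similar) (auto simp: affine_image_ball)

section \<open>The measure is carried by the interval from \<open>0\<close> to
  \<open>xi\<close>\<close>

lemma mu_bounded:
  obtains R where "R > 0" "measure \<mu> {..<-R} = 0" "measure \<mu> {R<..} = 0"
proof -
  obtain K where K: "compact K" "emeasure \<mu> K = 1" using ssim by (auto simp: self_similar_def)
  obtain R where R: "R > 0" "\<And>x. x \<in> K \<Longrightarrow> norm x \<le> R"
    using compact_imp_bounded[OF K(1)] by (auto simp: bounded_pos)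
  have Km: "K \<in> sets \<mu>" using K(1) by (simp add: sets_mu borel_compact)
  have "measure \<mu> K = 1" using K(2) by (simp add: measure_def)
  then have "measure \<mu> (- K) = 0"
    using prob_compl[OF Km] by (simp add: space_mu Compl_eq_Diff_UNIV)
  moreover have "- K \<in> sets borel" using Km by (simp add: sets_mu borel_comp)
  ultimately have z: "measure \<mu> A = 0" if "A \<subseteq> - K" for A
    using measure_mu_mono[OF that] by (simp add: measure_le_0_iff)
  show ?thesis using R by (intro that[of R] z) force+
qed

lemma measure_UN_null:
  fixes A :: "nat \<Rightarrow> real set"
  assumes "\<And>n. A n \<in> sets \<mu>" "\<And>n. measure \<mu> (A n) = 0"
  shows "measure \<mu> (\<Union>n. A n) = 0"
proof -
  have "(\<Union>n. A n) \<in> null_sets \<mu>"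
    using assms by (intro null_sets_UN) (auto simp: null_sets_def emeasure_eq_measure)
  then show ?thesis by (simp add: measure_eq_0_null_sets)
qed

text \<open>Digits are nonnegative, so self-similarity bounds the mass below \<open>-t\<close> by
  the mass below \<open>- d * t\<close>. Iteration moves the ray past the bound \<open>R\<close>,
  where there is no mass; letting \<open>t\<close> shrink to \<open>0\<close> exhausts the open
  ray.\<close>

lemma mu_below_0: "measure \<mu> {..<0} = 0"
proof -
  obtain R where R: "R > 0" "measure \<mu> {..<-R} = 0" using mu_bounded by blast
  have step: "measure \<mu> {..<-t} \<le> measure \<mu> {..<- (real d * t)}" for t
  proof -
    have "measure \<mu> {..<-t} = (\<Sum>i\<le>m. p i * measure \<mu> {..<real d * (-t) - real i})"
      by (subst measure_self_similar) (auto simp: affine_image_lessThan)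
    also have "\<dots> \<le> (\<Sum>i\<le>m. p i * measure \<mu> {..<- (real d * t)})"
      using ppos by (intro sum_mono mult_left_mono measure_mu_mono) (auto intro: less_imp_le)
    also have "\<dots> = measure \<mu> {..<- (real d * t)}" by (simp add: psum flip: sum_distrib_right)
    finally show ?thesis .
  qed
  have zero: "measure \<mu> {..<-t} = 0" if "t > 0" for t
  proof -
    have it: "measure \<mu> {..<-t} \<le> measure \<mu> {..<- (real d ^ n * t)}" for n
      by (induction n) (auto intro: order_trans[OF _ step] simp: mult.assoc)
    obtain n where "R / t < real d ^ n" using real_arch_pow[OF d_gt_1] by blast
    then have "measure \<mu> {..<- (real d ^ n * t)} \<le> measure \<mu> {..<-R}"
      using that by (intro measure_mu_mono) (auto simp: divide_simps)
    then show ?thesis using it[of n] R(2) by (simp add: measure_le_0_iff)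
  qed
  have "{..<0::real} = (\<Union>n. {..<- (1 / real (Suc n))})"
  proof -
    have "\<exists>n. x < - (1 / real (Suc n))" if neg: "x < 0" for x :: real
    proof -
      obtain n where "inverse (real (Suc n)) < - x" using reals_Archimedean[of "-x"] neg by auto
      then show ?thesis by (intro exI[of _ n]) (simp add: inverse_eq_divide)
    qed
    moreover have "x < 0" if "x < - (1 / real (Suc n))" for x :: real and n
      using that by (smt (verit) divide_pos_pos of_nat_0_less_iff zero_less_Suc zero_less_one)
    ultimately show ?thesis by blast
  qed
  moreover have "measure \<mu> (\<Union>n. {..<- (1 / real (Suc n))}) = 0"
    by (intro measure_UN_null) (auto simp: sets_mu zero)
  ultimately show ?thesis by simp
qed

text \<open>Mirror image of the argument at \<open>0\<close>: the map
  \<open>x \<mapsto> d * x - m\<close> fixes \<open>xi\<close>, and smaller digits only move the ray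
  further to the right.\<close>

lemma mu_above_xi: "measure \<mu> {xi<..} = 0"
proof -
  obtain R where R: "R > 0" "measure \<mu> {R<..} = 0" using mu_bounded by blast
  have step: "measure \<mu> {xi + t<..} \<le> measure \<mu> {xi + real d * t<..}" for t
  proof -
    have "measure \<mu> {xi + t<..} = (\<Sum>i\<le>m. p i * measure \<mu> {real d * (xi + t) - real i<..})"
      by (subst measure_self_similar) (auto simp: affine_image_greaterThan)
    also have "\<dots> \<le> (\<Sum>i\<le>m. p i * measure \<mu> {xi + real d * t<..})"
      using ppos xi_fixed
      by (intro sum_mono mult_left_mono measure_mu_mono) (auto intro: less_imp_le simp: algebra_simps)
    also have "\<dots> = measure \<mu> {xi + real d * t<..}" by (simp add: psum flip: sum_distrib_right)
    finally show ?thesis .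
  qed
  have zero: "measure \<mu> {xi + t<..} = 0" if "t > 0" for t
  proof -
    have it: "measure \<mu> {xi + t<..} \<le> measure \<mu> {xi + real d ^ n * t<..}" for n
      by (induction n) (auto intro: order_trans[OF _ step] simp: mult.assoc)
    obtain n where "R / t < real d ^ n" using real_arch_pow[OF d_gt_1] by blast
    then have "measure \<mu> {xi + real d ^ n * t<..} \<le> measure \<mu> {R<..}"
      using that xi_gt_1 by (intro measure_mu_mono) (auto simp: divide_simps)
    then show ?thesis using it[of n] R(2) by (simp add: measure_le_0_iff)
  qed
  have "{xi<..} = (\<Union>n. {xi + (1 / real (Suc n))<..})"
  proof -
    have "\<exists>n. x > xi + (1 / real (Suc n))" if "x > xi" for x :: real
      using reals_Archimedean[of "x - xi"] that by (auto simp: inverse_eq_divide algebra_simps)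
    moreover have "x > xi" if "x > xi + (1 / real (Suc n))" for x :: real and n
      using that by (smt (verit) divide_pos_pos of_nat_0_less_iff zero_less_Suc zero_less_one)
    ultimately show ?thesis by blast
  qed
  moreover have "measure \<mu> (\<Union>n. {xi + (1 / real (Suc n))<..}) = 0"
    by (intro measure_UN_null) (auto simp: sets_mu zero)
  ultimately show ?thesis by simp
qed

lemma measure_0_left: "A \<subseteq> {..<0} \<Longrightarrow> measure \<mu> A = 0"
  using measure_mu_mono[of A "{..<0}"] mu_below_0 by (simp add: measure_le_0_iff)

lemma measure_0_right: "A \<subseteq> {xi<..} \<Longrightarrow> measure \<mu> A = 0"
  using measure_mu_mono[of A "{xi<..}"] mu_above_xi by (simp add: measure_le_0_iff)

lemma measure_ball_left: "y + r \<le> 0 \<Longrightarrow> measure \<mu> (ball y r) = 0"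
  by (rule measure_0_left) (auto simp: dist_real_def)

lemma measure_ball_right: "y - r \<ge> xi \<Longrightarrow> measure \<mu> (ball y r) = 0"
  by (rule measure_0_right) (auto simp: dist_real_def)

lemma measure_ball_eq_1:
  assumes "0 \<le> y" "y \<le> xi" "r > xi"
  shows "measure \<mu> (ball y r) = 1"
proof -
  have "- ball y r \<subseteq> {..<0} \<union> {xi<..}" using assms by (auto simp: dist_real_def)
  then have "measure \<mu> (- ball y r) \<le> measure \<mu> ({..<0} \<union> {xi<..})"
    by (intro measure_mu_mono) auto
  also have "\<dots> \<le> measure \<mu> {..<0} + measure \<mu> {xi<..}"
    by (intro measure_Un_le) (auto simp: sets_mu)
  finally have "measure \<mu> (- ball y r) = 0"
    by (simp add: mu_below_0 mu_above_xi measure_le_0_iff)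
  then show ?thesis
    using prob_compl[of "ball y r"] by (simp add: sets_mu space_mu Compl_eq_Diff_UNIV)
qed

section \<open>Lower bounds for balls centred at points of the support\<close>

lemma p_le_1: "i \<le> m \<Longrightarrow> p i \<le> 1"
  using member_le_sum[of i "{..m}" p] psum ppos by (force intro: less_imp_le)

definition pmin :: real where
  "pmin = Min (p ` {..m})"

lemma pmin: "pmin > 0" "i \<le> m \<Longrightarrow> pmin \<le> p i" "pmin \<le> 1"
proof -
  show *: "i \<le> m \<Longrightarrow> pmin \<le> p i" for i by (auto simp: pmin_def)
  show "pmin > 0" using ppos by (auto simp: pmin_def)
  show "pmin \<le> 1" using *[of 0] p_le_1[of 0] by simp
qed

text \<open>Only the term of the first digit of \<omega> is kept in the self-similarity relation. It
  recentres at the shifted expansion and multiplies the radius by \<open>d\<close>; after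
  \<open>n\<close> steps the ball covers the support.\<close>

lemma measure_ball_lower:
  assumes "digits \<omega>" "real d ^ n * r > xi"
  shows "pmin ^ n \<le> measure \<mu> (ball (proj d \<omega>) r)"
  using assms
proof (induction n arbitrary: \<omega> r)
  case 0
  then show ?case using measure_ball_eq_1[of "proj d \<omega>" r] proj_bounds[of \<omega>] by simp
next
  case (Suc n)
  let ?c = "real d * proj d \<omega> - real (\<omega> 0)"
  have "pmin ^ n \<le> measure \<mu> (ball (proj d (\<lambda>i. \<omega> (Suc i))) (real d * r))"
    using Suc.prems by (intro Suc.IH) (auto simp: mult_ac)
  then have "pmin * pmin ^ n \<le> p (\<omega> 0) * measure \<mu> (ball ?c (real d * r))"
    using Suc.prems(1) pmin ppos by (intro mult_mono) (auto simp: proj_shift less_imp_le)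
  also have "\<dots> \<le> (\<Sum>i\<le>m. p i * measure \<mu> (ball (real d * proj d \<omega> - real i) (real d * r)))"
    using Suc.prems(1) ppos
    by (intro member_le_sum[of "\<omega> 0" "{..m}" "\<lambda>i. p i * measure \<mu> (ball (real d * proj d \<omega> - real i) (real d * r))"])
      (auto intro!: mult_nonneg_nonneg less_imp_le[OF ppos])
  finally show ?case by (simp flip: measure_ball_self_similar)
qed

text \<open>The number of steps depends on the radius alone, so the constant serves all centres at
  once.\<close>

lemma measure_ball_uniform_lower:
  assumes "r > 0"
  obtains c where "c > 0" "\<And>\<omega>. digits \<omega> \<Longrightarrow> c \<le> measure \<mu> (ball (proj d \<omega>) r)"
proof -
  obtain n where "xi / r < real d ^ n" using real_arch_pow[OF d_gt_1] by blast
  then have "real d ^ n * r > xi" using assms by (simp add: divide_simps)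
  then show ?thesis using that[of "pmin ^ n"] measure_ball_lower pmin(1) by auto
qed

lemma proj_in_support: "digits \<omega> \<Longrightarrow> proj d \<omega> \<in> support \<mu>"
  unfolding support_def by (smt (verit) measure_ball_uniform_lower mem_Collect_eq)

section \<open>Matrix products and words with a barrier digit\<close>

text \<open>Digits are renumbered as \<open>k - u\<close> with integer \<open>k\<close>, to match
  the translation indices of the matrices. Enlarging \<open>K\<close> is harmless because
  \<open>pext\<close> vanishes off the digits.\<close>

lemma measure_ball_self_similar_int:
  assumes "finite K" "{u..u + int m} \<subseteq> K"
  shows "measure \<mu> (ball y r) =
    (\<Sum>k\<in>K. pext m p (k - u) * measure \<mu> (ball (real d * y - of_int (k - u)) (real d * r)))"
proof -
  have "measure \<mu> (ball y r) = (\<Sum>k\<in>{u..u + int m}.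
      pext m p (k - u) * measure \<mu> (ball (real d * y - of_int (k - u)) (real d * r)))"
    unfolding measure_ball_self_similar[of y r]
    by (rule sum.reindex_bij_witness[of _ "\<lambda>k. nat (k - u)" "\<lambda>j. int j + u"])
      (auto simp: pext_def)
  also have "\<dots> = (\<Sum>k\<in>K.
      pext m p (k - u) * measure \<mu> (ball (real d * y - of_int (k - u)) (real d * r)))"
    using assms by (intro sum.mono_neutral_left) (auto simp: pext_def)
  finally show ?thesis .
qed

lemma Mi_carrier: "Mi d m p s \<in> carrier_mat 3 3"
  by (simp add: Mi_def a_par_1)

text \<open>Positions 0, 1, 2 stand for the indices -1, 0, 1, which explains the shifts by
  one.\<close>

lemma Mi_entry:
  assumes "r < 3" "c < 3"
  shows "Mi d m p s $$ (r,c) = pext m p (int r - 1 + int s - (int c - 1) * int d)"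
  using assms by (simp add: Mi_def a_par_1)

lemma Mword_Nil: "Mword d m p [] = 1\<^sub>m 3"
  by (simp add: Mword_def a_par_1)

lemma Mword_snoc: "Mword d m p (\<sigma> @ [s]) = Mi d m p s * Mword d m p \<sigma>"
  by (simp add: Mword_def)

lemma Mword_carrier: "Mword d m p \<sigma> \<in> carrier_mat 3 3"
  by (induction \<sigma> rule: rev_induct) (simp_all add: Mword_Nil Mword_snoc mult_carrier_mat[OF Mi_carrier])

lemma Mword_append: "Mword d m p (\<sigma> @ \<tau>) = Mword d m p \<tau> * Mword d m p \<sigma>"
proof (induction \<tau> rule: rev_induct)
  case (snoc s \<tau>)
  then show ?case
    using Mword_snoc[of "\<sigma> @ \<tau>" s] Mi_carrier Mword_carrier
    by (simp add: Mword_snoc assoc_mult_mat[of _ 3 3 _ 3 _ 3])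
qed (use Mword_carrier[of \<sigma>] in \<open>auto simp: Mword_Nil\<close>)

lemma pext_nonneg: "pext m p j \<ge> 0"
  using ppos by (auto simp: pext_def intro!: less_imp_le)

lemma Mi_nonneg: "r < 3 \<Longrightarrow> c < 3 \<Longrightarrow> Mi d m p s $$ (r,c) \<ge> 0"
  by (simp add: Mi_entry pext_nonneg)

lemma Mword_nonneg: "r < 3 \<Longrightarrow> c < 3 \<Longrightarrow> Mword d m p \<sigma> $$ (r,c) \<ge> 0"
proof (induction \<sigma> arbitrary: r c rule: rev_induct)
  case (snoc s \<sigma>)
  then show ?case
    by (auto simp: Mword_snoc mult_entry_3[OF Mi_carrier Mword_carrier] Mi_nonneg
        intro!: sum_nonneg mult_nonneg_nonneg)
qed (simp add: Mword_Nil)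

lemma Mword_append_entry:
  assumes "r < 3" "c < 3"
  shows "Mword d m p (\<sigma> @ \<tau>) $$ (r,c) =
    (\<Sum>k<3. Mword d m p \<tau> $$ (r,k) * Mword d m p \<sigma> $$ (k,c))"
  using assms by (simp add: Mword_append mult_entry_3[OF Mword_carrier Mword_carrier])

lemma Mword_append_entry_ge:
  assumes "r < 3" "c < 3" "k < 3"
  shows "Mword d m p \<tau> $$ (r,k) * Mword d m p \<sigma> $$ (k,c) \<le> Mword d m p (\<sigma> @ \<tau>) $$ (r,c)"
  unfolding Mword_append_entry[OF assms(1,2)]
  by (rule member_le_sum[of k "{..<3}" "\<lambda>k. Mword d m p \<tau> $$ (r,k) * Mword d m p \<sigma> $$ (k,c)"])
    (use assms in \<open>auto intro!: mult_nonneg_nonneg Mword_nonneg\<close>)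

lemma Mword_single: "Mword d m p [s] = Mi d m p s"
  using Mword_snoc[of "[]" s] Mi_carrier[of s] by (simp add: Mword_Nil)

text \<open>In the outer columns the argument of \<open>pext\<close> is shifted by \<open>d\<close>
  in one direction: it is at least \<open>b + d - 1 > m\<close> in column 0 and at most
  \<open>b + 1 - d < 0\<close> in column 2.\<close>

lemma Mi_barrier:
  assumes "r < 3" "c < 3" "c \<noteq> 1"
  shows "Mi d m p b $$ (r,c) = 0"
proof -
  have "int r - 1 + int b - (int c - 1) * int d < 0 \<or> int r - 1 + int b - (int c - 1) * int d > int m"
  proof (cases "c = 0")
    case True
    then show ?thesis using m_less by auto
  next
    case False
    then have "c = 2" using assms by auto
    then show ?thesis using b_plus_1_less assms by auto
  qed
  then show ?thesis using assms by (auto simp: Mi_entry pext_def)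
qed

text \<open>The first letter contributes the rightmost factor, so the zero columns of
  \<open>M_b\<close> survive in the product.\<close>

lemma Mword_barrier:
  assumes "r < 3" "c < 3" "c \<noteq> 1"
  shows "Mword d m p (b # \<sigma>) $$ (r,c) = 0"
  using Mword_append_entry[of r c "[b]" \<sigma>] assms by (simp add: Mword_single Mi_barrier)

section \<open>Weights of words\<close>

definition weight :: "nat list \<Rightarrow> real" where
  "weight \<sigma> = Mword d m p \<sigma> $$ (1,1)"

lemma weight_Nil: "weight [] = 1"
  by (simp add: weight_def Mword_Nil)

text \<open>The matrix of the word starting with \<open>b\<close> stands on the left of the product,
  and its only nonzero column selects the single term \<open>k = 1\<close>.\<close>

lemma weight_append_barrier: "weight (\<sigma> @ b # \<tau>) = weight (b # \<tau>) * weight \<sigma>"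
proof -
  have "weight (\<sigma> @ b # \<tau>) = (\<Sum>k<3. Mword d m p (b # \<tau>) $$ (1,k) * Mword d m p \<sigma> $$ (k,1))"
    by (simp add: weight_def Mword_append_entry)
  also have "\<dots> = (\<Sum>k\<in>{1}. Mword d m p (b # \<tau>) $$ (1,k) * Mword d m p \<sigma> $$ (k,1))"
    by (intro sum.mono_neutral_right) (auto simp: Mword_barrier)
  finally show ?thesis by (simp add: weight_def)
qed

text \<open>The central entry of \<open>M_s\<close> is \<open>p s\<close>, so the path that stays at
  the centre already contributes a product of probabilities.\<close>

lemma weight_lower:
  assumes "set \<sigma> \<subseteq> {0..m}"
  shows "pmin ^ length \<sigma> \<le> weight \<sigma>"
  using assms
proof (induction \<sigma> rule: rev_induct)
  case (snoc s \<sigma>)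
  have "pmin * pmin ^ length \<sigma> \<le> Mword d m p [s] $$ (1,1) * Mword d m p \<sigma> $$ (1,1)"
    using snoc pmin ppos
    by (intro mult_mono) (auto simp: Mword_single Mi_entry pext_def weight_def less_imp_le)
  also have "\<dots> \<le> weight (\<sigma> @ [s])"
    unfolding weight_def by (intro Mword_append_entry_ge) auto
  finally show ?case by simp
qed (simp add: weight_Nil)

lemma weight_pos: "set \<sigma> \<subseteq> {0..m} \<Longrightarrow> weight \<sigma> > 0"
  using weight_lower[of \<sigma>] pmin(1) by (smt (verit) zero_less_power)

text \<open>One step of self-similarity turns a translated ball into balls around
  \<open>z - k\<close>. Since the new radius is at most \<open>2 - xi\<close>, those with
  \<open>k\<close> outside -1, 0, 1 miss the support up to a null set, and the remaining
  coefficients are entries of the matrix.\<close>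

lemma measure_ball_Mi:
  assumes z: "z = real d * y - real i" "0 \<le> z" "z \<le> xi" and s: "real d * s \<le> 2 - xi" and c: "c < 3"
  shows "measure \<mu> (ball (y - (real c - 1)) s) =
    (\<Sum>r<3. measure \<mu> (ball (z - (real r - 1)) (real d * s)) * Mi d m p i $$ (r,c))"
proof -
  \<comment> \<open>With this offset, digit \<open>k - u\<close> leads exactly to the centre
    \<open>z - k\<close>.\<close>
  define u where "u = (int c - 1) * int d - int i"
  define f where "f k = pext m p (k - u) * measure \<mu> (ball (z - of_int k) (real d * s))" for k
  have "measure \<mu> (ball (y - (real c - 1)) s) = (\<Sum>k\<in>{u..u + int m} \<union> {-1..1}.
      pext m p (k - u) *
        measure \<mu> (ball (real d * (y - (real c - 1)) - of_int (k - u)) (real d * s)))"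
    by (rule measure_ball_self_similar_int) auto
  also have "\<dots> = sum f ({u..u + int m} \<union> {-1..1})"
  proof (rule sum.cong[OF refl])
    fix k
    have "real d * (y - (real c - 1)) - of_int (k - u) = z - of_int k"
      unfolding z(1) u_def by (simp add: algebra_simps)
    then show "pext m p (k - u) *
        measure \<mu> (ball (real d * (y - (real c - 1)) - of_int (k - u)) (real d * s)) = f k"
      by (simp only: f_def)
  qed
  also have "\<dots> = sum f {-1..1}"
  proof (intro sum.mono_neutral_right ballI)
    fix k assume "k \<in> {u..u + int m} \<union> {-1..1} - {-1..1}"
    then consider "k \<le> -2" | "k \<ge> 2" by force
    then have "measure \<mu> (ball (z - of_int k) (real d * s)) = 0"
    proof cases
      case 1
      then show ?thesis using z s by (intro measure_ball_right) linarith
    next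
      case 2
      then show ?thesis using z s by (intro measure_ball_left) linarith
    qed
    then show "f k = 0" by (simp add: f_def)
  qed auto
  also have "\<dots> = (\<Sum>r<3. f (int r - 1))"
    by (rule sum.reindex_bij_witness[of _ "\<lambda>r. int r - 1" "\<lambda>k. nat (k + 1)"]) auto
  also have "\<dots> = (\<Sum>r<3. measure \<mu> (ball (z - (real r - 1)) (real d * s)) * Mi d m p i $$ (r,c))"
    using c by (intro sum.cong) (auto simp: f_def Mi_entry u_def algebra_simps)
  finally show ?thesis .
qed

text \<open>The measures of the three translated balls form a row vector, and reading one more digit
  inserts one matrix. The radius condition passes to shorter prefixes because
  \<open>d > 1\<close>.\<close>

lemma measure_ball_Mword:
  assumes \<omega>: "digits \<omega>" and s: "real d ^ n * s \<le> 2 - xi" "s > 0" and c: "c < 3"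
  shows "measure \<mu> (ball (proj d \<omega> - (real c - 1)) s) =
    (\<Sum>r<3. measure \<mu> (ball (proj d (\<lambda>i. \<omega> (n + i)) - (real r - 1)) (real d ^ n * s)) *
       Mword d m p (map \<omega> [0..<n]) $$ (r,c))"
  using s(1)
proof (induction n)
  case 0
  have "(\<Sum>r<3. measure \<mu> (ball (proj d \<omega> - (real r - 1)) s) * (1\<^sub>m 3 :: real mat) $$ (r,c)) =
    (\<Sum>r\<in>{c}. measure \<mu> (ball (proj d \<omega> - (real r - 1)) s) * (1\<^sub>m 3 :: real mat) $$ (r,c))"
    using c by (intro sum.mono_neutral_right) auto
  then show ?case using c by (simp add: Mword_Nil)
next
  case (Suc n)
  define y where "y = proj d (\<lambda>i. \<omega> (n + i))"
  define z where "z = proj d (\<lambda>i. \<omega> (Suc n + i))"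
  have z: "z = real d * y - real (\<omega> n)" "0 \<le> z" "z \<le> xi"
    using proj_shift[of "\<lambda>i. \<omega> (n + i)"] proj_bounds[of "\<lambda>i. \<omega> (Suc n + i)"] \<omega>
    by (auto simp: y_def z_def)
  have ds: "real d * (real d ^ n * s) \<le> 2 - xi" using Suc.prems by (simp add: mult_ac)
  have "real d ^ n * s \<le> real d * (real d ^ n * s)"
    using mult_right_mono[of 1 "real d" "real d ^ n * s"] d_gt_1 s(2) by simp
  then have "measure \<mu> (ball (proj d \<omega> - (real c - 1)) s) =
      (\<Sum>r<3. measure \<mu> (ball (y - (real r - 1)) (real d ^ n * s)) *
         Mword d m p (map \<omega> [0..<n]) $$ (r,c))"
    unfolding y_def using ds by (intro Suc.IH) simp
  also have "\<dots> = (\<Sum>r<3. (\<Sum>k<3. measure \<mu> (ball (z - (real k - 1)) (real d * (real d ^ n * s))) *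
      Mi d m p (\<omega> n) $$ (k,r)) * Mword d m p (map \<omega> [0..<n]) $$ (r,c))"
    by (intro sum.cong refl) (simp add: measure_ball_Mi[OF z ds])
  also have "\<dots> = (\<Sum>k<3. measure \<mu> (ball (z - (real k - 1)) (real d * (real d ^ n * s))) *
      (\<Sum>r<3. Mi d m p (\<omega> n) $$ (k,r) * Mword d m p (map \<omega> [0..<n]) $$ (r,c)))"
    unfolding sum_distrib_left sum_distrib_right by (subst sum.swap) (simp add: mult_ac)
  also have "\<dots> = (\<Sum>k<3. measure \<mu> (ball (z - (real k - 1)) (real d ^ Suc n * s)) *
      Mword d m p (map \<omega> [0..<Suc n]) $$ (k,c))"
    using c by (intro sum.cong) (simp_all add: Mword_snoc mult_entry_3[OF Mi_carrier Mword_carrier] mult_ac)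
  finally show ?case by (simp add: z_def)
qed

text \<open>An expansion \<open>y\<close> starting with \<open>b\<close> lies between
  \<open>b / d\<close> and \<open>(b + xi) / d\<close>. The two terms bound from below the distance
  of \<open>y - 1\<close> to \<open>0\<close> and of \<open>y + 1\<close> to
  \<open>xi\<close>.\<close>

definition gap :: real where
  "gap = min (1 - (real b + xi) / real d) (real b / real d + 1 - xi)"

lemma gap_pos: "gap > 0"
  using barrier_upper barrier_lower d_gt_1 by (simp add: gap_def)

lemma gap_less: "gap < 2 - xi"
proof -
  have "real b / real d < 1" using b_plus_1_less by simp
  then show ?thesis by (simp add: gap_def)
qed

text \<open>A barrier digit at position \<open>n\<close> keeps the neighbouring integer translates of the
  rescaled ball away from the support, so only the central entry of the matrix product counts.\<close>

lemma measure_ball_barrier: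
  assumes \<omega>: "digits \<omega>" "\<omega> n = b" and s: "real d ^ n * s = gap"
  shows "measure \<mu> (ball (proj d \<omega>) s) =
    weight (map \<omega> [0..<n]) * measure \<mu> (ball (proj d (\<lambda>i. \<omega> (n + i))) gap)"
proof -
  define y where "y = proj d (\<lambda>i. \<omega> (n + i))"
  define z where "z = proj d (\<lambda>i. \<omega> (Suc n + i))"
  have z: "z = real d * y - real b" "0 \<le> z" "z \<le> xi"
    using proj_shift[of "\<lambda>i. \<omega> (n + i)"] proj_bounds[of "\<lambda>i. \<omega> (Suc n + i)"] \<omega>
    by (auto simp: y_def z_def)
  then have y: "real b / real d \<le> y" "y \<le> (real b + xi) / real d"
    using d_gt_1 by (auto simp: divide_simps algebra_simps)
  have "real d ^ n * s > 0" using s gap_pos by simp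
  then have s0: "s > 0" using d_gt_1 by (simp add: zero_less_mult_iff)
  have left: "measure \<mu> (ball (y + 1) gap) = 0"
    using y by (intro measure_ball_right) (simp add: gap_def)
  have right: "measure \<mu> (ball (y - 1) gap) = 0"
    using y by (intro measure_ball_left) (simp add: gap_def)
  have "measure \<mu> (ball (proj d \<omega> - (real 1 - 1)) s) =
      (\<Sum>r<3. measure \<mu> (ball (y - (real r - 1)) gap) * Mword d m p (map \<omega> [0..<n]) $$ (r,1))"
    unfolding y_def using measure_ball_Mword[OF \<omega>(1) _ s0, of n 1] s gap_less by simp
  also have "\<dots> = measure \<mu> (ball y gap) * weight (map \<omega> [0..<n])"
    using left right by (simp add: eval_nat_numeral weight_def)
  finally show ?thesis by (simp add: y_def)
qed

section \<open>Realizing local dimensions\<close>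

text \<open>Here the measures along the scales \<open>1 / d ^ n\<close> form an exact geometric
  sequence, so the logarithmic error is constant.\<close>

lemma has_local_dim_geometric:
  assumes q: "q > 0" and x: "measure \<mu> (ball x 1) > 0"
    and step: "\<And>r. r \<le> 1 \<Longrightarrow> measure \<mu> (ball x (r / real d)) = q * measure \<mu> (ball x r)"
  shows "has_local_dim \<mu> x (delta_log d q)"
proof -
  have eq: "measure \<mu> (ball x (1 / real d ^ n)) = q ^ n * measure \<mu> (ball x 1)" for n
  proof (induction n)
    case (Suc n)
    have "measure \<mu> (ball x (1 / real d ^ n / real d)) = q * measure \<mu> (ball x (1 / real d ^ n))"
      using d_gt_1 by (intro step) simp
    then show ?case using Suc by (simp add: mult_ac)
  qed simp
  show ?thesis
  proof (rule has_local_dim_along_scales[where N = "\<lambda>i. i" and g = 1 and L = 1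
        and C = "\<bar>ln (measure \<mu> (ball x 1))\<bar>"])
    show "\<bar>ln (measure \<mu> (ball x (1 / real d ^ i))) - real i * ln q\<bar> \<le> \<bar>ln (measure \<mu> (ball x 1))\<bar>" for i
      unfolding eq using q x by (simp add: ln_mult ln_realpow)
  qed (use q x d3 sets_mu eq finite_measure_axioms in auto)
qed

text \<open>At the point \<open>0\<close>, a digit \<open>i \<ge> 1\<close> leads to a ball around
  \<open>- i\<close> of radius at most one, which has no mass.\<close>

lemma alpha_upper_in_local_dims: "delta_log d (p 0) \<in> local_dims \<mu>"
proof -
  have sup: "0 \<in> support \<mu>"
    using proj_in_support[of "\<lambda>_. 0"] proj_const[of 0] by simp
  have "measure \<mu> (ball 0 (r / real d)) = p 0 * measure \<mu> (ball 0 r)" if "r \<le> 1" for r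
  proof -
    have "measure \<mu> (ball 0 (r / real d)) = (\<Sum>i\<le>m. p i * measure \<mu> (ball (- real i) r))"
      using measure_ball_self_similar[of 0 "r / real d"] d_gt_1 by simp
    also have "\<dots> = (\<Sum>i\<in>{0}. p i * measure \<mu> (ball (- real i) r))"
      using that by (intro sum.mono_neutral_right) (auto intro!: measure_ball_left)
    finally show ?thesis by simp
  qed
  then have "has_local_dim \<mu> 0 (delta_log d (p 0))"
    using sup ppos by (intro has_local_dim_geometric) (auto simp: support_def)
  then show ?thesis using sup by (auto simp: local_dims_def)
qed

text \<open>At the point \<open>xi\<close>, a digit \<open>i < m\<close> leads to a centre at least
  one unit beyond \<open>xi\<close>, so only digit \<open>m\<close> contributes.\<close>

lemma delta_log_p_m_in_local_dims: "delta_log d (p m) \<in> local_dims \<mu>"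
proof -
  have sup: "xi \<in> support \<mu>"
    using proj_in_support[of "\<lambda>_. m"] proj_const[of m] by (simp add: xi_def)
  have "measure \<mu> (ball xi (r / real d)) = p m * measure \<mu> (ball xi r)" if "r \<le> 1" for r
  proof -
    have "measure \<mu> (ball xi (r / real d)) = (\<Sum>i\<le>m. p i * measure \<mu> (ball (xi + real m - real i) r))"
      using measure_ball_self_similar[of xi "r / real d"] d_gt_1 by (simp add: xi_fixed)
    also have "\<dots> = (\<Sum>i\<in>{m}. p i * measure \<mu> (ball (xi + real m - real i) r))"
      using that by (intro sum.mono_neutral_right) (auto intro!: measure_ball_right)
    finally show ?thesis by simp
  qed
  then have "has_local_dim \<mu> xi (delta_log d (p m))"
    using sup ppos by (intro has_local_dim_geometric) (auto simp: support_def)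
  then show ?thesis using sup by (auto simp: local_dims_def)
qed

text \<open>Since \<open>b\<close> follows each prefix, the measure of the ball at that scale is the
  weight times a factor between a uniform \<open>c\<close> and \<open>1\<close>. Bounded jumps of
  the prefix lengths then cover all radii.\<close>

lemma local_dim_of_bounded_prefixes:
  fixes P :: "nat \<Rightarrow> nat list"
  assumes \<omega>: "digits \<omega>" and t: "t > 0"
    and P: "P 0 = []" "\<And>i. P i = map \<omega> [0..<length (P i)]" "\<And>i. \<omega> (length (P i)) = b"
    and len: "\<And>i. length (P i) < length (P (Suc i))"
      "\<And>i. length (P (Suc i)) \<le> length (P i) + L"
    and bound: "\<And>i. \<bar>ln (weight (P i)) - real (length (P i)) * ln t\<bar> \<le> C"
  shows "delta_log d t \<in> local_dims \<mu>"
proof -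
  obtain c where c: "c > 0" "\<And>\<omega>. digits \<omega> \<Longrightarrow> c \<le> measure \<mu> (ball (proj d \<omega>) gap)"
    using measure_ball_uniform_lower[OF gap_pos] by blast
  have wpos: "weight (P i) > 0" for i
    by (subst P(2)) (use \<omega> in \<open>auto intro!: weight_pos\<close>)
  have bnd: "measure \<mu> (ball (proj d \<omega>) (gap / real d ^ length (P i))) > 0 \<and>
    \<bar>ln (measure \<mu> (ball (proj d \<omega>) (gap / real d ^ length (P i)))) - real (length (P i)) * ln t\<bar>
      \<le> C + \<bar>ln c\<bar>" for i
  proof -
    define m1 where "m1 = measure \<mu> (ball (proj d (\<lambda>j. \<omega> (length (P i) + j))) gap)"
    have m1: "c \<le> m1" "m1 \<le> 1" unfolding m1_def using c(2) \<omega> by auto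
    have eq: "measure \<mu> (ball (proj d \<omega>) (gap / real d ^ length (P i))) = weight (P i) * m1"
      unfolding m1_def
      using measure_ball_barrier[OF \<omega> P(3)[of i], of "gap / real d ^ length (P i)"] d_gt_1 P(2)[of i]
      by simp
    have "ln (weight (P i) * m1) = ln (weight (P i)) + ln m1"
      using wpos[of i] m1 c(1) by (simp add: ln_mult)
    moreover have "ln c \<le> ln m1" "ln m1 \<le> 0" using m1 c(1) by auto
    ultimately have "\<bar>ln (weight (P i) * m1) - real (length (P i)) * ln t\<bar> \<le> C + \<bar>ln c\<bar>"
      using bound[of i] by linarith
    then show ?thesis unfolding eq using wpos[of i] m1(1) c(1) by auto
  qed
  have grow: "i \<le> length (P i)" for i
  proof (induction i)
    case (Suc i)
    then show ?case using len(1)[of i] by simp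
  qed simp
  have "has_local_dim \<mu> (proj d \<omega>) (delta_log d t)"
    using bnd grow len P(1) d3 sets_mu gap_pos t finite_measure_axioms
    by (intro has_local_dim_along_scales[where N = "\<lambda>i. length (P i)" and g = gap and L = L
          and C = "C + \<bar>ln c\<bar>"]) (simp_all add: less_imp_le)
  then show ?thesis using proj_in_support[OF \<omega>] by (auto simp: local_dims_def)
qed

text \<open>Concatenating the two blocks greedily keeps the logarithm of the weight within bounded
  distance of its target.\<close>

lemma local_dim_of_two_blocks:
  assumes u: "set (b # u) \<subseteq> {0..m}" "t ^ length (b # u) \<le> weight (b # u)"
    and v: "set (b # v) \<subseteq> {0..m}" "weight (b # v) \<le> t ^ length (b # v)"
    and t: "t > 0"
  shows "delta_log d t \<in> local_dims \<mu>"
proof -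
  \<comment> \<open>\<open>F\<close> measures how far the logarithm of the weight is from the
    target; its sign decides which block comes next.\<close>
  define F where "F q = ln (weight q) - real (length q) * ln t" for q
  define w where "w q = (if F q \<le> 0 then b # u else b # v)" for q
  define P where "P n = ((\<lambda>q. q @ w q) ^^ n) []" for n
  have P0: "P 0 = []" and PS: "P (Suc n) = P n @ w (P n)" for n
    by (auto simp: P_def)
  have digP: "set (P n) \<subseteq> {0..m}" for n
    by (induction n) (use u(1) v(1) in \<open>auto simp: P0 PS w_def\<close>)
  have wpos: "weight (P n) > 0" for n by (rule weight_pos[OF digP])
  have len: "length (P n) < length (P (Suc n))"
      "length (P (Suc n)) \<le> length (P n) + (length u + length v + 1)" for n
    by (auto simp: PS w_def)
  have grow: "n \<le> length (P n)" for n
  proof (induction n)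
    case (Suc n)
    then show ?case using len(1)[of n] by simp
  qed simp
  \<comment> \<open>Multiplicativity of weights makes \<open>F\<close> additive, because every block
    begins with \<open>b\<close>.\<close>
  have F_append: "F (q @ b # s) = F q + F (b # s)"
    if "weight q > 0" "set (b # s) \<subseteq> {0..m}" for q s
    using that weight_pos[OF that(2)]
    by (simp add: F_def weight_append_barrier ln_mult algebra_simps)
  have Fu: "F (b # u) \<ge> 0"
  proof -
    have "ln (t ^ length (b # u)) \<le> ln (weight (b # u))"
      using u(2) t by (intro ln_mono zero_less_power)
    then show ?thesis unfolding F_def using ln_realpow[of t "length (b # u)"] by linarith
  qed
  have Fv: "F (b # v) \<le> 0"
  proof -
    have "ln (weight (b # v)) \<le> ln (t ^ length (b # v))"
      using v(2) weight_pos[OF v(1)] by (intro ln_mono)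
    then show ?thesis unfolding F_def using ln_realpow[of t "length (b # v)"] by linarith
  qed
  have bound: "\<bar>F (P n)\<bar> \<le> \<bar>F (b # u)\<bar> + \<bar>F (b # v)\<bar>" for n
  proof (induction n)
    case 0
    show ?case by (simp add: P0 F_def weight_Nil)
  next
    case (Suc n)
    show ?case
    proof (cases "F (P n) \<le> 0")
      case True
      then have "F (P (Suc n)) = F (P n) + F (b # u)"
        using F_append[OF wpos u(1)] by (simp add: PS w_def)
      then show ?thesis using True Suc Fu by linarith
    next
      case False
      then have "F (P (Suc n)) = F (P n) + F (b # v)"
        using F_append[OF wpos v(1)] by (simp add: PS w_def)
      then show ?thesis using False Suc Fv by linarith
    qed
  qed
  \<comment> \<open>\<open>P (Suc j)\<close> has more than \<open>j\<close> letters, so this access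
    is in range.\<close>
  define \<omega> where "\<omega> j = P (Suc j) ! j" for j
  have stable: "P (n + k) ! j = P n ! j \<and> j < length (P (n + k))" if "j < length (P n)" for n k j
    by (induction k) (use that in \<open>auto simp: PS nth_append\<close>)
  have nth: "P n ! j = \<omega> j" if "j < length (P n)" for n j
  proof (cases "n \<le> Suc j")
    case True
    then show ?thesis using stable[OF that, of "Suc j - n"] by (simp add: \<omega>_def)
  next
    case False
    have "j < length (P (Suc j))" using grow[of "Suc j"] by simp
    then show ?thesis using stable[of j "Suc j" "n - Suc j"] False by (simp add: \<omega>_def)
  qed
  have digits: "digits \<omega>"
  proof
    fix j
    have "\<omega> j \<in> set (P (Suc j))" unfolding \<omega>_def using grow[of "Suc j"] by (intro nth_mem) simp
    then show "\<omega> j \<le> m" using digP[of "Suc j"] by auto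
  qed
  have prefix: "P n = map \<omega> [0..<length (P n)]" for n
    by (rule nth_equalityI) (auto simp: nth)
  have next_b: "\<omega> (length (P n)) = b" for n
    using nth[OF len(1)[of n]] by (cases "F (P n) \<le> 0") (simp_all add: PS w_def nth_append)
  show ?thesis
    by (rule local_dim_of_bounded_prefixes[OF digits t P0 prefix next_b len bound[unfolded F_def]])
qed

section \<open>Comparison of weights with spectral radii\<close>

lemma map_mat_carrier_3: "map_mat complex_of_real (Mword d m p \<sigma>) \<in> carrier_mat 3 3"
  using Mword_carrier[of \<sigma>] by simp

lemma rho_nonneg: "rho (Mword d m p \<sigma>) \<ge> 0"
  using spectral_radius_mem_max(1)[OF map_mat_carrier_3, of \<sigma>] by (auto simp: rho_def)

lemma rho_le_sum: "rho (Mword d m p \<sigma>) \<le> (\<Sum>r<3. \<Sum>c<3. Mword d m p \<sigma> $$ (r,c))"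
proof -
  have "rho (Mword d m p \<sigma>) \<le> (\<Sum>r<3. \<Sum>c<3. norm (map_mat complex_of_real (Mword d m p \<sigma>) $$ (r,c)))"
    unfolding rho_def by (rule spectral_radius_le_sum_norm[OF map_mat_carrier_3]) simp
  also have "\<dots> = (\<Sum>r<3. \<Sum>c<3. Mword d m p \<sigma> $$ (r,c))"
    using Mword_carrier[of \<sigma>] by (intro sum.cong) (auto simp: Mword_nonneg)
  finally show ?thesis .
qed

text \<open>Needed for the words consisting only of \<open>b\<close>, which keep the generalized
  spectral radius away from zero.\<close>

lemma weight_le_rho_barrier:
  assumes "set (b # \<sigma>) \<subseteq> {0..m}"
  shows "weight (b # \<sigma>) \<le> rho (Mword d m p (b # \<sigma>))"
proof -
  let ?A = "map_mat complex_of_real (Mword d m p (b # \<sigma>))"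
  let ?w = "complex_of_real (weight (b # \<sigma>))"
  note A = map_mat_carrier_3[of "b # \<sigma>"]
  define v where "v = col ?A 1" \<comment> \<open>the only nonzero column, hence an eigenvector\<close>
  have v: "v \<in> carrier_vec 3" using carrier_matD(1)[OF Mword_carrier] by (auto simp: v_def intro!: carrier_vecI)
  have v1: "vec_index v 1 = ?w"
    using A by (simp add: v_def weight_def)
  have "v \<noteq> 0\<^sub>v 3"
    using v1 weight_pos[OF assms] by auto
  moreover have "?A *\<^sub>v v = ?w \<cdot>\<^sub>v v"
  proof (rule eq_vecI)
    fix i assume "i < dim_vec (?w \<cdot>\<^sub>v v)"
    then have i: "i < 3" using v by simp
    have "vec_index (?A *\<^sub>v v) i = (\<Sum>k<3. ?A $$ (i,k) * vec_index v k)"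
      using i v A by (auto simp: scalar_prod_def lessThan_atLeast0 intro!: sum.cong)
    also have "\<dots> = (\<Sum>k\<in>{1}. ?A $$ (i,k) * vec_index v k)"
      using i A Mword_carrier[of "b # \<sigma>"]
      by (intro sum.mono_neutral_right) (auto simp: Mword_barrier)
    also have "\<dots> = vec_index (?w \<cdot>\<^sub>v v) i"
      using i v v1 A by (simp add: v_def)
    finally show "vec_index (?A *\<^sub>v v) i = vec_index (?w \<cdot>\<^sub>v v) i" .
  qed (use A v in auto)
  ultimately have "?w \<in> spectrum ?A"
    using A v by (auto simp: spectrum_def eigenvalue_def eigenvector_def)
  then have "norm ?w \<le> rho (Mword d m p (b # \<sigma>))"
    unfolding rho_def by (intro spectral_radius_mem_max(2)[OF A] imageI) simp
  then show ?thesis by simp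
qed

text \<open>Some entry \<open>(r,c)\<close> carries at least a ninth of the spectral radius. A
  leading \<open>b\<close> joins the centre to \<open>c\<close> and a final letter \<open>s\<close>
  joins \<open>r\<close> to the centre, each at the cost of a factor at least
  \<open>pmin\<close>.\<close>

lemma heavy_barrier_word:
  assumes \<sigma>: "set \<sigma> \<subseteq> {0..m}"
  obtains s where "s \<le> m" "pmin\<^sup>2 / 9 * rho (Mword d m p \<sigma>) \<le> weight (b # \<sigma> @ [s])"
proof -
  have "\<exists>r<3. \<exists>c<3. rho (Mword d m p \<sigma>) \<le> 9 * Mword d m p \<sigma> $$ (r,c)"
  proof (rule ccontr)
    assume "\<not> ?thesis"
    then have "Mword d m p \<sigma> $$ (r,c) < rho (Mword d m p \<sigma>) / 9" if "r < 3" "c < 3" for r c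
      using that by force
    then have "(\<Sum>r<3. \<Sum>c<3. Mword d m p \<sigma> $$ (r,c)) <
        (\<Sum>r<(3::nat). \<Sum>c<(3::nat). rho (Mword d m p \<sigma>) / 9)"
      by (intro sum_strict_mono) (auto simp: lessThan_empty_iff)
    then show False using rho_le_sum[of \<sigma>] by simp
  qed
  then obtain r c where rc: "r < 3" "c < 3" "rho (Mword d m p \<sigma>) \<le> 9 * Mword d m p \<sigma> $$ (r,c)"
    by blast
  \<comment> \<open>The entry of \<open>M_s\<close> at \<open>(1,r)\<close> is then
    \<open>p d\<close>, \<open>p 0\<close>, \<open>p 0\<close> for \<open>r\<close> = 0, 1,
    2.\<close>
  define s where "s = (if r = 2 then d else 0)"
  have s: "s \<le> m" using md by (simp add: s_def)
  have row: "pmin \<le> Mi d m p s $$ (1,r)"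
  proof -
    consider "r = 0" | "r = 1" | "r = 2" using rc(1) by linarith
    then show ?thesis
      by cases (use md pmin(2) in \<open>auto simp: s_def Mi_entry pext_def\<close>)
  qed
  \<comment> \<open>These entries are the probabilities of \<open>b - 1\<close>, \<open>b\<close>,
    \<open>b + 1\<close>, all of them digits.\<close>
  have col: "pmin \<le> Mi d m p b $$ (c,1)"
    using rc(2) b_ge_1 b_plus_1_less md pmin(2) by (auto simp: Mi_entry pext_def)
  have "pmin * (Mword d m p \<sigma> $$ (r,c) * pmin) \<le>
      Mi d m p s $$ (1,r) * (Mword d m p \<sigma> $$ (r,c) * Mi d m p b $$ (c,1))"
    using row col pmin(1) Mword_nonneg[OF rc(1,2)] by (intro mult_mono) auto
  also have "\<dots> \<le> Mi d m p s $$ (1,r) * Mword d m p ([b] @ \<sigma>) $$ (r,1)"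
    using rc Mword_append_entry_ge[of r 1 c \<sigma> "[b]"]
    by (intro mult_left_mono Mi_nonneg) (auto simp: Mword_single)
  also have "\<dots> \<le> weight (b # \<sigma> @ [s])"
    using rc Mword_append_entry_ge[of 1 1 r "[s]" "b # \<sigma>"] by (simp add: weight_def Mword_single)
  finally have "pmin\<^sup>2 * Mword d m p \<sigma> $$ (r,c) \<le> weight (b # \<sigma> @ [s])"
    by (simp add: power2_eq_square mult_ac)
  moreover have "pmin\<^sup>2 * rho (Mword d m p \<sigma>) \<le> pmin\<^sup>2 * (9 * Mword d m p \<sigma> $$ (r,c))"
    using rc(3) by (intro mult_left_mono) auto
  ultimately show ?thesis using s by (intro that[of s]) auto
qed

lemma Mword_power:
  "Mword d m p (concat (replicate k \<sigma>)) = Mword d m p \<sigma> ^\<^sub>m k"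
proof (induction k)
  case (Suc k)
  have "concat (replicate (Suc k) \<sigma>) = \<sigma> @ concat (replicate k \<sigma>)" by simp
  then show ?case using Suc by (simp only: Mword_append pow_mat.simps)
qed (use Mword_carrier[of \<sigma>] in \<open>simp add: Mword_Nil\<close>)

text \<open>The entries for the \<open>k\<close>-fold repetition of \<sigma> grow at most like
  \<open>s ^ k\<close> with \<open>s\<close> strictly below \<open>t ^ length \<sigma>\<close>. For
  large \<open>k\<close> this margin absorbs the cost of the leading \<open>b\<close>.\<close>

lemma light_barrier_word:
  assumes \<sigma>: "\<sigma> \<noteq> []" "set \<sigma> \<subseteq> {0..m}" and t: "t > 0"
    and rho: "rho (Mword d m p \<sigma>) < t ^ length \<sigma>"
  obtains v where "set (b # v) \<subseteq> {0..m}" "weight (b # v) \<le> t ^ length (b # v)"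
proof -
  obtain s where s: "rho (Mword d m p \<sigma>) < s" "s < t ^ length \<sigma>"
    using dense[OF rho] by blast
  have s0: "s > 0" using s(1) rho_nonneg[of \<sigma>] by simp
  let ?A = "map_mat complex_of_real (Mword d m p \<sigma>)"
  obtain C where C: "\<And>k i j. i < 3 \<Longrightarrow> j < 3 \<Longrightarrow> norm ((?A ^\<^sub>m k) $$ (i,j)) \<le> C * s ^ k"
    using pow_mat_bound_of_spectral_radius_less[OF map_mat_carrier_3 _ s(1)[unfolded rho_def] s0]
    by auto
  have bound: "Mword d m p (concat (replicate k \<sigma>)) $$ (i,j) \<le> C * s ^ k" if "i < 3" "j < 3" for k i j
  proof -
    have "?A ^\<^sub>m k = map_mat complex_of_real (Mword d m p (concat (replicate k \<sigma>)))"
      unfolding Mword_power by (rule of_real_hom.mat_hom_pow[OF Mword_carrier, symmetric])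
    then show ?thesis using C[OF that, of k] that Mword_carrier[of "concat (replicate k \<sigma>)"] by auto
  qed
  have "1 < t ^ length \<sigma> / s" using s s0 by simp
  \<comment> \<open>The factor 3 counts the terms of the sum below, and the extra letter
    \<open>b\<close> accounts for the division by \<open>t\<close>.\<close>
  then obtain k where k: "3 * C / t < (t ^ length \<sigma> / s) ^ k" using real_arch_pow by blast
  define v where "v = concat (replicate k \<sigma>)"
  have "weight (b # v) = (\<Sum>i<3. Mword d m p v $$ (1,i) * Mi d m p b $$ (i,1))"
    using Mword_append_entry[of 1 1 "[b]" v] by (simp add: weight_def Mword_single)
  also have "\<dots> \<le> (\<Sum>i<(3::nat). C * s ^ k * 1)"
  proof (intro sum_mono mult_mono)
    fix i :: nat assume i: "i \<in> {..<3}"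
    show "Mword d m p v $$ (1,i) \<le> C * s ^ k" unfolding v_def using i by (intro bound) auto
    then show "0 \<le> C * s ^ k" using Mword_nonneg[of 1 i v] i by auto
    show "Mi d m p b $$ (i,1) \<le> 1" using i p_le_1 by (auto simp: Mi_entry pext_def)
    show "0 \<le> Mi d m p b $$ (i,1)" using i by (intro Mi_nonneg) auto
  qed
  also have "\<dots> = 3 * C * s ^ k" by simp
  also have "\<dots> \<le> t * (t ^ length \<sigma>) ^ k"
    using k t s0 by (simp add: power_divide divide_simps mult_ac)
  also have "\<dots> = t ^ length (b # v)"
  proof -
    have "length v = length \<sigma> * k" by (simp add: v_def length_concat sum_list_replicate)
    then show ?thesis by (simp add: power_mult)
  qed
  finally show ?thesis
    using \<sigma>(2) b_le by (intro that[of v]) (auto simp: v_def)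
qed

text \<open>The \<open>k\<close>-th term of the sequence whose upper limit is the generalized
  spectral radius.\<close>

definition max_rho_root :: "nat \<Rightarrow> real" where
  "max_rho_root k = (Sup (rho ` Mword d m p ` words m k)) powr (1 / real k)"

lemma finite_words: "finite (words m k)"
  using finite_lists_length_eq[of "{0..m}" k] by (simp add: words_def conj_commute)

lemma max_rho_root_attained:
  obtains \<sigma> where "\<sigma> \<in> words m k" "max_rho_root k = rho (Mword d m p \<sigma>) powr (1 / real k)"
proof -
  have "replicate k 0 \<in> words m k" by (auto simp: words_def)
  then have "Sup (rho ` Mword d m p ` words m k) \<in> rho ` Mword d m p ` words m k"
    using finite_words[of k] by (subst cSup_eq_Max) (auto intro!: Max_in)
  then show ?thesis using that by (auto simp: max_rho_root_def)
qed

lemma pmin_le_max_rho_root: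
  assumes "k > 0"
  shows "pmin \<le> max_rho_root k"
proof -
  obtain j where j: "k = Suc j" using assms by (cases k) auto
  let ?\<sigma> = "b # replicate j b"
  have \<sigma>: "?\<sigma> \<in> words m k" "set ?\<sigma> \<subseteq> {0..m}" using b_le by (auto simp: words_def j)
  have "pmin ^ k \<le> weight ?\<sigma>" using weight_lower[OF \<sigma>(2)] by (simp add: j)
  also have "\<dots> \<le> rho (Mword d m p ?\<sigma>)" by (rule weight_le_rho_barrier[OF \<sigma>(2)])
  also have "\<dots> \<le> Sup (rho ` Mword d m p ` words m k)"
    using \<sigma>(1) finite_words[of k] by (intro cSup_upper) auto
  finally have "(pmin ^ k) powr (1 / real k) \<le> max_rho_root k"
    unfolding max_rho_root_def using pmin(1) by (intro powr_mono2) auto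
  then show ?thesis
    using pmin(1) assms by (simp add: powr_realpow[symmetric] powr_powr)
qed

text \<open>A number \<open>T\<close> strictly between \<open>t\<close> and the upper limit leaves
  an exponential margin \<open>(T / t) ^ k\<close>, which pays for the loss
  \<open>pmin\<^sup>2 / 9\<close> and for the two added letters.\<close>

lemma heavy_barrier_word_of_limsup:
  assumes t: "t > 0" "ereal t < limsup (\<lambda>k. ereal (max_rho_root k))"
  obtains u where "set (b # u) \<subseteq> {0..m}" "t ^ length (b # u) \<le> weight (b # u)"
proof -
  obtain T where T: "t < T" "ereal T < limsup (\<lambda>k. ereal (max_rho_root k))"
    using ereal_dense2[OF t(2)] by auto
  have "1 < T / t" using T t by simp
  \<comment> \<open>The factor \<open>t\<^sup>2\<close> comes from the two letters put around
    \<sigma>.\<close>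
  then obtain K where K: "9 * t\<^sup>2 / pmin\<^sup>2 < (T / t) ^ K" using real_arch_pow by blast
  have "\<exists>k\<ge>Suc K. T < max_rho_root k"
  proof (rule ccontr)
    assume "\<not> ?thesis"
    then have "\<forall>\<^sub>F k in sequentially. ereal (max_rho_root k) \<le> ereal T"
      by (intro eventually_sequentiallyI[of "Suc K"]) force
    then have "limsup (\<lambda>k. ereal (max_rho_root k)) \<le> ereal T" by (rule Limsup_bounded)
    then show False using T(2) by simp
  qed
  then obtain k where k: "k \<ge> Suc K" "T < max_rho_root k" by blast
  obtain \<sigma> where \<sigma>: "\<sigma> \<in> words m k" "max_rho_root k = rho (Mword d m p \<sigma>) powr (1 / real k)"
    by (rule max_rho_root_attained)
  have dig: "set \<sigma> \<subseteq> {0..m}" and len: "length \<sigma> = k" using \<sigma>(1) by (auto simp: words_def)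
  have big: "T ^ k < rho (Mword d m p \<sigma>)"
    using k T t \<sigma>(2) rho_nonneg by (intro less_power_of_less_root) auto
  obtain s where s: "s \<le> m" "pmin\<^sup>2 / 9 * rho (Mword d m p \<sigma>) \<le> weight (b # \<sigma> @ [s])"
    using heavy_barrier_word[OF dig] by blast
  have "(T / t) ^ K \<le> (T / t) ^ k" using k(1) \<open>1 < T / t\<close> by (intro power_increasing) auto
  then have "9 * t\<^sup>2 / pmin\<^sup>2 \<le> T ^ k / t ^ k" using K by (simp add: power_divide)
  then have "t\<^sup>2 * t ^ k \<le> pmin\<^sup>2 / 9 * T ^ k"
    using pmin(1) t by (simp add: divide_simps mult_ac)
  also have "\<dots> \<le> pmin\<^sup>2 / 9 * rho (Mword d m p \<sigma>)"
    using big by (intro mult_left_mono) auto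
  also note s(2)
  finally have "t ^ length (b # \<sigma> @ [s]) \<le> weight (b # \<sigma> @ [s])"
    by (simp add: len power2_eq_square mult_ac)
  then show ?thesis using dig s(1) b_le by (intro that[of "\<sigma> @ [s]"]) auto
qed

text \<open>As \<open>delta_log\<close> reverses order, the two bounds on \<alpha> place
  \<open>t\<close> below the generalized spectral radius and above the infimum; each yields one of
  the two blocks.\<close>

lemma interval_in_local_dims:
  assumes \<alpha>: "alpha_lower d m p < \<alpha>" "\<alpha> < alpha_star d m p"
  shows "\<alpha> \<in> local_dims \<mu>"
proof -
  define t where "t = exp (- \<alpha> * ln (real d))"
  have t: "t > 0" by (simp add: t_def)
  have lnd: "ln (real d) > 0" using d_gt_1 by simp
  have \<alpha>t: "\<alpha> = delta_log d t" using lnd by (simp add: delta_log_def t_def)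
  have delta_less: "delta_log d x < delta_log d y \<longleftrightarrow> ln y < ln x" for x y
    using lnd by (simp add: delta_log_def divide_simps)
  have "ereal t < limsup (\<lambda>k. ereal (max_rho_root k))" (is "_ < ?L")
  proof -
    \<comment> \<open>A positive lower bound is needed to remove the logarithms: for a finite limit
      it makes \<open>ln\<close> monotone there, and for an infinite limit the claim is immediate
      despite the default value of \<open>real_of_ereal\<close>.\<close>
    have "ereal pmin \<le> ?L"
      by (intro le_Limsup eventually_sequentiallyI[of 1]) (auto simp: pmin_le_max_rho_root)
    moreover have "ln t < ln (real_of_ereal ?L)"
      using \<alpha>(1) unfolding \<alpha>t alpha_lower_def delta_less
      by (simp add: gen_spec_rad_def max_rho_root_def)
    ultimately show ?thesis
      using pmin(1) t by (cases ?L) auto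
  qed
  then obtain u where u: "set (b # u) \<subseteq> {0..m}" "t ^ length (b # u) \<le> weight (b # u)"
    using heavy_barrier_word_of_limsup[OF t] by blast
  define S where "S = {rho (Mword d m p \<sigma>) powr (1 / real (length \<sigma>)) | \<sigma>.
      \<sigma> \<noteq> [] \<and> set \<sigma> \<subseteq> {0..m} \<and> hd \<sigma> \<notin> {0, m}}"
  have "[b] \<noteq> [] \<and> set [b] \<subseteq> {0..m} \<and> hd [b] \<notin> {0, m}"
    using b_ge_1 b_plus_1_less md by auto
  then have ne: "S \<noteq> {}" unfolding S_def by blast
  have "Inf S \<ge> 0" by (intro cInf_greatest[OF ne]) (auto simp: S_def)
  moreover have "ln (Inf S) < ln t"
    using \<alpha>(2) unfolding \<alpha>t alpha_star_def delta_less S_def .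
  \<comment> \<open>If the infimum is \<open>0\<close>, its logarithm is a default value and the
    inequality follows from \<open>t > 0\<close> instead.\<close>
  ultimately have "Inf S < t" using t by (cases "Inf S = 0") auto
  then obtain \<sigma> where \<sigma>: "\<sigma> \<noteq> []" "set \<sigma> \<subseteq> {0..m}"
      "rho (Mword d m p \<sigma>) powr (1 / real (length \<sigma>)) < t"
    using cInf_lessD[OF ne] unfolding S_def by auto
  then have "rho (Mword d m p \<sigma>) < t ^ length \<sigma>"
    using rho_nonneg by (intro power_less_of_root_less) auto
  then obtain v where "set (b # v) \<subseteq> {0..m}" "weight (b # v) \<le> t ^ length (b # v)"
    using light_barrier_word[OF \<sigma>(1,2) t] by blast
  then show ?thesis unfolding \<alpha>t using local_dim_of_two_blocks[OF u] t by blast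
qed

end

theorem theorem3:
  fixes d m :: nat and p :: "nat \<Rightarrow> real" and \<mu> :: "real measure" and b :: nat
  assumes "d \<ge> 3" and "m \<ge> d"
    and "\<forall>i\<le>m. p i > 0" and "(\<Sum>i\<le>m. p i) = 1"
    and "p 0 \<le> p m" and "\<forall>i. 1 \<le> i \<and> i \<le> m - 1 \<longrightarrow> p m \<le> p i"
    and "self_similar d m p \<mu>"
    and "barrier_digit d m b"
  shows "{alpha_lower d m p <..< alpha_star d m p} \<union> {delta_log d (p m)} \<union> {alpha_upper d m p}
           \<subseteq> local_dims \<mu>"
proof -
  interpret barrier_system d m p \<mu> b
    by unfold_locales (use assms in auto)
  show ?thesis
    using interval_in_local_dims delta_log_p_m_in_local_dims alpha_upper_in_local_dims
    by (auto simp: alpha_upper_def)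
qed

end
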